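(* Let $\{\ell_n\}_{n\in\mathbb{N}}$ be a decreasing sequence of positive numbers with $\ell_n\in(0,1)$, and let $$\delta=\liminf_{n\to\infty}\left(\frac{n\ell_n}{\ln n}\right).$$ If $\delta<1$, then there is no probability density $f\in L^1(\mathbb{T})$ such that $\Pr(\omega\colon\mathbb{T}\subset\mathcal{U}(\omega,f))=1$; that is, there is no density $f\in L^1(\mathbb{T})$ such that, if the centers are sampled independently with respect to $f$, one has a uniform random covering of the whole circle.
   Context: $\mathbb{T}=\mathbb{R}/\mathbb{Z}$ is the circle. For a probability density $f\in L^1(\mathbb{T})$ (with respect to Lebesgue measure), let $\{\omega_n\}_{n\in\mathbb{N}}$ be an i.i.d. sequence of $\mathbb{T}$-valued random variables with density $f$. Put $r_n=\ell_n/2$, let $B(x,r)=(x-r,x+r)\subset\mathbb{T}$ be the open arc of center $x$ and radius $r$, let $E_n=\bigcup_{k=1}^{n}B(\omega_k,r_n)$, and define $\mathcal{U}(\omega,f)=\liminf_{n\to\infty}E_n=\bigcup_{N\ge1}\bigcap_{n\ge N}E_n$. *)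

theory Defs
  imports "HOL-Probability.Probability"
begin

quotient_type circle = real / "\<lambda>x y. x - y \<in> \<int>"
proof (rule equivpI)
  show "reflp (\<lambda>x y::real. x - y \<in> \<int>)"
    by (simp add: reflp_def)
  show "symp (\<lambda>x y::real. x - y \<in> \<int>)"
    by (metis (no_types, lifting) Ints_minus minus_diff_eq sympI)
  show "transp (\<lambda>x y::real. x - y \<in> \<int>)"
    by (rule transpI) (metis Ints_add diff_add_cancel add_diff_eq)
qed

instantiation circle :: topological_space
begin

definition open_circle :: "circle set \<Rightarrow> bool" where
  "open_circle A \<longleftrightarrow> open (abs_circle -` A)"

instance
  by standard (auto simp: open_circle_def vimage_Union vimage_Int)

end

definition circle_lebesgue :: "circle measure" where
  "circle_lebesgue = distr (restrict_space lborel {0..<1}) borel abs_circle"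

lemma measurable_abs_circle: "abs_circle \<in> borel \<rightarrow>\<^sub>M borel"
  by (intro borel_measurable_continuous_onI continuous_on_open_vimage[THEN iffD2])
     (auto simp: open_circle_def)

lemma prob_space_circle_lebesgue: "prob_space circle_lebesgue"
proof -
  have "prob_space (restrict_space lborel {0..<1::real})"
    by (rule prob_spaceI) (simp add: space_restrict_space emeasure_restrict_space)
  then show ?thesis
    unfolding circle_lebesgue_def
    by (rule prob_space.prob_space_distr)
       (rule measurable_restrict_space1, use measurable_abs_circle in simp)
qed

text \<open>The arc does not depend on the representative of its centre, and it is the whole circle
  once the radius exceeds one half.\<close>

definition arc_ball :: "circle \<Rightarrow> real \<Rightarrow> circle set" where
  "arc_ball x r = abs_circle ` {rep_circle x - r <..< rep_circle x + r}"

lemma arc_ball_abs: "arc_ball (abs_circle a) r = abs_circle ` {a - r <..< a + r}"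
proof -
  define d where "d = rep_circle (abs_circle a) - a"
  have "abs_circle (rep_circle (abs_circle a)) = abs_circle a"
    by (rule Quotient3_abs_rep[OF Quotient3_circle])
  then have d: "d \<in> \<int>"
    by (simp add: circle.abs_eq_iff d_def)
  have shift: "abs_circle (y + d) = abs_circle y" for y
    using d by (simp add: circle.abs_eq_iff)
  have "{rep_circle (abs_circle a) - r <..< rep_circle (abs_circle a) + r}
          = (\<lambda>y. y + d) ` {a - r <..< a + r}"
    by (auto simp: d_def intro!: image_eqI[of _ _ "_ - d"])
  then show ?thesis
    by (simp add: arc_ball_def image_image shift)
qed

text \<open>Elements of \<open>L\<^sup>1\<close> are determined only up to null sets, hence nonnegativity almost everywhere.\<close>

definition circle_density :: "(circle \<Rightarrow> real) \<Rightarrow> bool" where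
  "circle_density f \<longleftrightarrow>
     integrable circle_lebesgue f \<and> (AE x in circle_lebesgue. 0 \<le> f x) \<and>
     integral\<^sup>L circle_lebesgue f = 1"

definition iid_with_density ::
    "'a measure \<Rightarrow> (nat \<Rightarrow> 'a \<Rightarrow> circle) \<Rightarrow> (circle \<Rightarrow> real) \<Rightarrow> bool" where
  "iid_with_density M X f \<longleftrightarrow>
     prob_space.indep_vars M (\<lambda>_. borel) X {1..} \<and>
     (\<forall>k\<ge>1. distributed M circle_lebesgue (X k) (\<lambda>x. ennreal (f x)))"

definition covered_at :: "(nat \<Rightarrow> real) \<Rightarrow> (nat \<Rightarrow> circle) \<Rightarrow> nat \<Rightarrow> circle set" where
  "covered_at l w n = (\<Union>k\<in>{1..n}. arc_ball (w k) (l n / 2))"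

definition uniformly_covered :: "(nat \<Rightarrow> real) \<Rightarrow> (nat \<Rightarrow> circle) \<Rightarrow> circle set" where
  "uniformly_covered l w = (\<Union>N\<in>{1..}. \<Inter>n\<in>{N..}. covered_at l w n)"

end

(* Let Y be the coordinate in [0,1) of the random centers and let A be the set of t in (0,1) with
   f(t) <= 1; it has positive Lebesgue measure since f has mean 1, and the law of Y is dominated by
   Lebesgue measure on A. Fix a compact K in A of positive measure and let Z be the measure of the
   part of K that is not covered at time n. Arcs around points at distance at least l n are disjoint,
   so Var Z <= 2 (l n) E Z and by Chebyshev P(Z = 0) <= 2 (l n) / E Z. The average over K of the
   hitting probability of an arc is at most (1 + o(1)) l n, so by convexity
   E Z >= |K| (1 - (1 + o(1)) l n)^n, which along the times with n (l n) <= c ln n, c < 1, is at least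
   of order n^(-c') with c' < 1, whereas l n is of order at most ln n / n. Hence almost surely Z > 0
   infinitely often.

   Uniform covering is pointwise: the time after which x stays covered may depend on x, so a single
   point is needed that is uncovered infinitely often. Applying the above to K inside A and [p,q]
   for all rational p, q at once, one selects nested rational intervals that carry mass of A and are
   disjoint from the covered set at infinitely many times, and takes their common point. *)

theory Submission
  imports Defs "HOL-Real_Asymp.Real_Asymp"
begin

section \<open>Second moment method for the measure of random sections\<close>

text \<open>Let \<open>Z w\<close> be the measure of the section at \<open>w\<close>. By Fubini, E Z
  integrates the one-point probabilities and E Z^2 the two-point ones. Since \<open>pair\<close>
  gives nonpositive correlation up to an error supported on \<open>D x\<close>, Var Z <= s * E Z,
  and Chebyshev yields P(Z = 0) <= s / E Z. The product form also covers E Z = 0.\<close>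

lemma (in prob_space) second_moment_section:
  fixes L :: "'b measure" and U :: "('a \<times> 'b) set"
  assumes "finite_measure L" and U: "U \<in> sets (M \<Otimes>\<^sub>M L)" and "0 \<le> s"
    and pair: "\<And>x y. x \<in> space L \<Longrightarrow> y \<in> space L \<Longrightarrow>
      prob {w\<in>space M. (w, x) \<in> U \<and> (w, y) \<in> U}
        \<le> prob {w\<in>space M. (w, x) \<in> U} * prob {w\<in>space M. (w, y) \<in> U}
          + prob {w\<in>space M. (w, x) \<in> U} * indicator (D x) y"
    and D: "\<And>x. x \<in> space L \<Longrightarrow> D x \<in> sets L" "\<And>x. x \<in> space L \<Longrightarrow> measure L (D x) \<le> s"
  shows "prob {w\<in>space M. measure L (Pair w -` U) = 0} * (\<integral>x. prob {w\<in>space M. (w, x) \<in> U} \<partial>L) \<le> s"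
proof -
  interpret L: finite_measure L by fact
  interpret P: pair_sigma_finite M L by unfold_locales
  interpret PL: finite_measure "M \<Otimes>\<^sub>M L"
    by (rule finite_measure_pair_measure) (unfold_locales)
  note U [measurable]
  define u where "u w x = indicat_real U (w, x)" for w x
  define q where "q x = prob {w\<in>space M. (w, x) \<in> U}" for x
  define Z where "Z w = measure L (Pair w -` U)" for w
  have u_meas [measurable]: "case_prod u \<in> borel_measurable (M \<Otimes>\<^sub>M L)"
    unfolding u_def by (simp add: case_prod_unfold)
  have u01: "0 \<le> u w x" "u w x \<le> 1" for w x
    by (auto simp: u_def indicator_def)
  have Zu: "Z w = (\<integral>x. u w x \<partial>L)" if "w \<in> space M" for w
  proof -
    have "Pair w -` U \<in> sets L" by (rule sets_Pair1[OF U])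
    moreover have "u w = indicat_real (Pair w -` U)"
      by (auto simp: u_def indicator_def fun_eq_iff)
    ultimately show ?thesis
      using sets.sets_into_space by (simp add: Z_def Int_absorb2)
  qed
  have Z_meas [measurable]: "Z \<in> borel_measurable M"
  proof -
    have "(\<lambda>w. \<integral>x. u w x \<partial>L) \<in> borel_measurable M" by measurable
    then show ?thesis by (subst measurable_cong[OF Zu]) auto
  qed
  have Zb: "0 \<le> Z w" "Z w \<le> measure L (space L)" for w
    unfolding Z_def using L.bounded_measure by auto
  have Zi: "integrable M Z"
    using Zb by (intro integrable_const_bound[where B="measure L (space L)"]) auto
  have Z2i: "integrable M (\<lambda>w. (Z w)\<^sup>2)"
    using Zb by (intro integrable_const_bound[where B="(measure L (space L))\<^sup>2"]) (auto intro: power_mono)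
  have qu: "q x = (\<integral>w. u w x \<partial>M)" if "x \<in> space L" for x
  proof -
    have "{w\<in>space M. (w, x) \<in> U} \<in> events" using that by measurable
    moreover have "(\<integral>w. u w x \<partial>M) = (\<integral>w. indicat_real {w\<in>space M. (w, x) \<in> U} w \<partial>M)"
      by (intro Bochner_Integration.integral_cong) (auto simp: u_def indicator_def)
    ultimately show ?thesis
      by (simp add: q_def Int_absorb2)
  qed
  have q01: "0 \<le> q x" "q x \<le> 1" for x by (auto simp: q_def)
  have q_meas [measurable]: "q \<in> borel_measurable L"
  proof -
    have "(\<lambda>x. \<integral>w. u w x \<partial>M) \<in> borel_measurable L" by measurable
    then show ?thesis by (subst measurable_cong[OF qu]) auto
  qed
  have qi: "integrable L q"
    using q01 by (intro L.integrable_const_bound[where B=1]) auto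
  define E where "E = (\<integral>x. q x \<partial>L)"
  have E0: "0 \<le> E" using q01 by (simp add: E_def)
  have EZ: "expectation Z = E"
  proof -
    have "expectation Z = (\<integral>w. (\<integral>x. u w x \<partial>L) \<partial>M)"
      by (intro Bochner_Integration.integral_cong) (auto simp: Zu)
    also have "\<dots> = (\<integral>x. (\<integral>w. u w x \<partial>M) \<partial>L)"
      using u01 by (intro P.Fubini_integral[symmetric] PL.integrable_const_bound[where B=1]) auto
    also have "\<dots> = E"
      unfolding E_def by (intro Bochner_Integration.integral_cong) (auto simp: qu)
    finally show ?thesis .
  qed
  have uu: "(\<integral>w. u w x * u w y \<partial>M) \<le> q x * q y + q x * indicator (D x) y"
    if "x \<in> space L" "y \<in> space L" for x y
  proof -
    have "{w\<in>space M. (w, x) \<in> U \<and> (w, y) \<in> U} \<in> events" using that by measurable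
    moreover have "(\<integral>w. u w x * u w y \<partial>M) = (\<integral>w. indicat_real {w\<in>space M. (w, x) \<in> U \<and> (w, y) \<in> U} w \<partial>M)"
      by (intro Bochner_Integration.integral_cong) (auto simp: u_def indicator_def)
    ultimately show ?thesis
      using pair[OF that] by (simp add: q_def Int_absorb2)
  qed
  \<comment> \<open>E Z^2 is treated one variable at a time: with \<open>x\<close> fixed,
    integrating \<open>pair\<close> over \<open>y\<close> gives \<open>q x * E\<close> from the
    product term and at most \<open>q x * s\<close> from \<open>D x\<close>.\<close>
  have uZ: "(\<integral>w. u w x * Z w \<partial>M) \<le> q x * (E + s)" if x: "x \<in> space L" for x
  proof -
    have [measurable]: "(\<lambda>w. u w x) \<in> borel_measurable M" using x by measurable
    have m: "(\<lambda>p. u (fst p) x * u (fst p) (snd p)) \<in> borel_measurable (M \<Otimes>\<^sub>M L)"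
      using u_meas by (simp add: case_prod_unfold)
    have int2: "integrable (M \<Otimes>\<^sub>M L) (\<lambda>(w, y). u w x * u w y)"
      using u01 m by (intro PL.integrable_const_bound[where B=1]) (auto simp: case_prod_unfold mult_le_one)
    have ind: "integrable L (indicat_real (D x))"
      using D(1)[OF x] by (intro integrable_real_indicator) (auto simp: L.emeasure_eq_measure)
    have "(\<integral>w. u w x * Z w \<partial>M) = (\<integral>w. (\<integral>y. u w x * u w y \<partial>L) \<partial>M)"
      by (intro Bochner_Integration.integral_cong) (auto simp: Zu)
    also have "\<dots> = (\<integral>y. (\<integral>w. u w x * u w y \<partial>M) \<partial>L)"
      by (rule P.Fubini_integral[symmetric, OF int2])
    also have "\<dots> \<le> (\<integral>y. q x * q y + q x * indicator (D x) y \<partial>L)"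
    proof (rule integral_mono)
      show "integrable L (\<lambda>y. \<integral>w. u w x * u w y \<partial>M)"
        using P.integrable_snd[OF int2] by simp
      show "integrable L (\<lambda>y. q x * q y + q x * indicator (D x) y)"
        using qi ind by auto
    qed (use uu x in auto)
    also have "\<dots> = q x * E + q x * measure L (D x)"
      using qi ind sets.sets_into_space[OF D(1)[OF x]] by (simp add: E_def Int_absorb2)
    also have "\<dots> \<le> q x * (E + s)"
      using D(2)[OF x] q01 by (simp add: distrib_left mult_left_mono)
    finally show ?thesis .
  qed
  have "expectation (\<lambda>w. (Z w)\<^sup>2) \<le> E * (E + s)"
  proof -
    have uZ_le: "u w x * Z w \<le> measure L (space L)" for w x
      proof -
      have "u w x * Z w \<le> 1 * measure L (space L)" by (intro mult_mono u01 Zb) simp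
      then show ?thesis by simp
    qed
    have int3: "integrable (M \<Otimes>\<^sub>M L) (\<lambda>(w, x). u w x * Z w)"
      using u01 Zb by (intro PL.integrable_const_bound[where B="measure L (space L)"] AE_I2)
        (use uZ_le in \<open>auto simp: case_prod_unfold abs_mult\<close>)
    have "expectation (\<lambda>w. (Z w)\<^sup>2) = (\<integral>w. (\<integral>x. u w x * Z w \<partial>L) \<partial>M)"
      by (intro Bochner_Integration.integral_cong) (auto simp: Zu power2_eq_square)
    also have "\<dots> = (\<integral>x. (\<integral>w. u w x * Z w \<partial>M) \<partial>L)"
      by (rule P.Fubini_integral[symmetric, OF int3])
    also have "\<dots> \<le> (\<integral>x. q x * (E + s) \<partial>L)"
      using P.integrable_snd[OF int3] qi uZ by (intro integral_mono) auto
    finally show ?thesis by (simp add: E_def)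
  qed
  then have var: "variance Z \<le> E * s"
    using variance_eq[OF Zi Z2i] by (simp add: EZ power2_eq_square distrib_left)
  show ?thesis
  proof (cases "E = 0")
    case False
    \<comment> \<open>Vanishing of \<open>Z\<close> is a deviation from the mean by the full amount
      \<open>E\<close>.\<close>
    have "prob {w\<in>space M. Z w = 0} \<le> prob {w\<in>space M. E \<le> \<bar>Z w - expectation Z\<bar>}"
      using E0 by (intro finite_measure_mono) (auto simp: EZ)
    also have "\<dots> \<le> variance Z / E\<^sup>2"
      using False E0 Z2i by (intro Chebyshev_inequality) auto
    also have "\<dots> \<le> E * s / E\<^sup>2"
      using var by (intro divide_right_mono) auto
    also have "\<dots> = s / E" by (simp add: power2_eq_square)
    finally have "prob {w\<in>space M. Z w = 0} * E \<le> s"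
      using False E0 by (simp add: pos_le_divide_eq)
    then show ?thesis by (simp add: Z_def E_def q_def)
  qed (use \<open>0 \<le> s\<close> in \<open>simp add: E_def q_def\<close>)
qed

section \<open>Convexity, independence and averaged ball masses\<close>

text \<open>Convexity of the power function in the form needed for a Jensen-type lower bound after
  integration. In the induction, \<open>x\<close> times the tangent for \<open>n\<close> exceeds the
  tangent for \<open>Suc n\<close> by n a^(n-1) (x - a)^2.\<close>

lemma power_tangent: "a ^ n + real n * a ^ (n - 1) * (x - a) \<le> x ^ n" if "0 \<le> a" "0 \<le> x" for a x::real
proof (induction n)
  case (Suc n)
  have "a ^ Suc n + real (Suc n) * a ^ n * (x - a) \<le> x * (a ^ n + real n * a ^ (n - 1) * (x - a))"
  proof (cases n)
    case (Suc m)
    have "x * (a ^ n + real n * a ^ (n - 1) * (x - a)) - (a ^ Suc n + real (Suc n) * a ^ n * (x - a))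
      = real n * a ^ m * (x - a)\<^sup>2"
      unfolding Suc by (simp add: algebra_simps power2_eq_square)
    moreover have "\<dots> \<ge> 0" using that by simp
    ultimately show ?thesis by linarith
  qed (simp add: algebra_simps)
  also have "\<dots> \<le> x * x ^ n" using Suc that by (intro mult_left_mono) auto
  finally show ?case by simp
qed simp

lemma (in prob_space) prob_iid_all:
  assumes "indep_vars (\<lambda>_. N) Y {1..}" "\<And>k. 1 \<le> k \<Longrightarrow> distr M N (Y k) = \<mu>"
    and S: "S \<in> sets N"
  shows "prob {w\<in>space M. \<forall>k\<in>{1..n}. Y k w \<in> S} = measure \<mu> S ^ n"
\<comment> \<open>An intersection over an empty index set would be the whole type instead of
  \<open>space M\<close>, so \<open>n = 0\<close>, where both sides are 1, is split off.\<close>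
proof (cases "n = 0")
  case False
  have Y: "Y k \<in> M \<rightarrow>\<^sub>M N" if "1 \<le> k" for k
    using assms(1) that by (auto simp: indep_vars_def)
  have "{w\<in>space M. \<forall>k\<in>{1..n}. Y k w \<in> S} = (\<Inter>k\<in>{1..n}. Y k -` S \<inter> space M)"
    using False by (auto simp: Suc_le_eq)
  also have "prob \<dots> = (\<Prod>k\<in>{1..n}. prob (Y k -` S \<inter> space M))"
    using False S by (intro indep_varsD[OF assms(1)]) auto
  also have "\<dots> = (\<Prod>k\<in>{1..n}. measure \<mu> S)"
    using S Y assms(2) by (intro prod.cong refl) (metis atLeastAtMost_iff measure_distr)
  finally show ?thesis by simp
qed (simp add: prob_space)

lemma borel_measurable_measure_ball:
  fixes M :: "real measure"
  assumes "finite_measure M" and smu [measurable_cong]: "sets M = sets borel"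
  shows "(\<lambda>x. measure M {x - r<..<x + r}) \<in> borel_measurable borel"
proof -
  interpret finite_measure M by fact
  have "(\<lambda>x. \<integral>y. indicat_real {p. \<bar>fst p - snd p\<bar> < r} (x, y) \<partial>M) \<in> borel_measurable borel"
    by measurable
  moreover have "(\<integral>y. indicat_real {p. \<bar>fst p - snd p\<bar> < r} (x, y) \<partial>M) = measure M {x - r<..<x + r}" for x
  proof -
    have "(\<lambda>y. indicat_real {p. \<bar>fst p - snd p\<bar> < r} (x, y)) = indicat_real {x - r<..<x + r}"
      by (auto simp: fun_eq_iff indicator_def)
    then show ?thesis
      using sets.sets_into_space[of "{x - r<..<x + r}" M] by (simp add: smu Int_absorb2)
  qed
  ultimately show ?thesis by simp
qed

text \<open>Exchanging the integrals turns the left side into the \<open>M\<close>-integral over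
  \<open>y\<close> of the Lebesgue measure of \<open>K\<close> within distance \<open>r\<close> of
  \<open>y\<close>. This is at most \<open>2 * r\<close>, and it vanishes unless \<open>y\<close> is
  closer than \<open>r\<close> to \<open>K\<close>.\<close>

lemma integral_measure_ball_le:
  fixes K :: "real set" and M :: "real measure"
  assumes "finite_measure M" and smu [measurable_cong]: "sets M = sets borel" and K: "closed K" "bounded K" and r: "0 < r"
  shows "(\<integral>x. measure M {x - r<..<x + r} \<partial>density lborel (indicator K))
           \<le> 2 * r * measure M {y. infdist y K < r}"
proof -
  interpret finite_measure M by fact
  define L where "L = density lborel (indicator K)"
  have [measurable]: "K \<in> sets borel" using K by auto
  have [measurable_cong]: "sets L = sets borel" by (simp add: L_def)
  have fin: "emeasure lborel K < \<infinity>" by (rule emeasure_bounded_finite) fact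
  have mL: "measure L S = measure lborel (K \<inter> S)" if "S \<in> sets borel" for S
    using that by (simp add: L_def measure_restricted)
  interpret L: finite_measure L
    by standard (use fin in \<open>simp add: L_def emeasure_restricted less_top[symmetric]\<close>)
  interpret P: pair_sigma_finite M L by unfold_locales
  interpret PL: finite_measure "M \<Otimes>\<^sub>M L"
    by (rule finite_measure_pair_measure) unfold_locales
  define b where "b y x = indicat_real {p. \<bar>fst p - snd p\<bar> < r} (y, x)" for y x :: real
  have [measurable]: "case_prod b \<in> borel_measurable (M \<Otimes>\<^sub>M L)"
    unfolding b_def case_prod_unfold by measurable
  have nb: "open {y. infdist y K < r}"
    by (intro open_Collect_less continuous_intros)
  have "(\<integral>x. measure M {x - r<..<x + r} \<partial>L) = (\<integral>x. (\<integral>y. b y x \<partial>M) \<partial>L)"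
  proof (intro Bochner_Integration.integral_cong refl)
    fix x
    have "b = (\<lambda>y x. indicat_real {x - r<..<x + r} y)"
      by (auto simp: b_def fun_eq_iff indicator_def)
    then show "measure M {x - r<..<x + r} = (\<integral>y. b y x \<partial>M)"
      using sets.sets_into_space[of "{x - r<..<x + r}" M] by (simp add: smu Int_absorb2)
  qed
  also have "\<dots> = (\<integral>y. (\<integral>x. b y x \<partial>L) \<partial>M)"
    by (intro P.Fubini_integral PL.integrable_const_bound[where B=1]) (auto simp: b_def indicator_def)
  also have "\<dots> = (\<integral>y. measure L {y - r<..<y + r} \<partial>M)"
  proof (intro Bochner_Integration.integral_cong refl)
    fix y
    have "b = (\<lambda>y. indicat_real {y - r<..<y + r})"
      by (auto simp: b_def fun_eq_iff indicator_def)
    then show "(\<integral>x. b y x \<partial>L) = measure L {y - r<..<y + r}"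
      using sets.sets_into_space[of "{y - r<..<y + r}" L] by (simp add: L_def)
  qed
  also have "\<dots> \<le> (\<integral>y. 2 * r * indicator {y. infdist y K < r} y \<partial>M)"
  proof (intro integral_mono)
    have [measurable]: "(\<lambda>y. measure L {y - r<..<y + r}) \<in> borel_measurable borel"
      by (rule borel_measurable_measure_ball) (auto simp: L_def L.finite_measure_axioms[unfolded L_def])
    show "integrable M (\<lambda>y. measure L {y - r<..<y + r})"
      by (intro integrable_const_bound[where B="measure L (space L)"])
        (auto intro: L.bounded_measure)
    show "integrable M (\<lambda>y. 2 * r * indicator {y. infdist y K < r} y)"
      using nb by (intro integrable_mult_right integrable_real_indicator)
        (auto simp: smu emeasure_eq_measure)
    fix y
    show "measure L {y - r<..<y + r} \<le> 2 * r * indicator {y. infdist y K < r} y"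
    proof (cases "infdist y K < r")
      case True
      have "measure lborel (K \<inter> {y - r<..<y + r}) \<le> measure lborel {y - r<..<y + r}"
        using r by (intro measure_mono_fmeasurable) (auto simp: fmeasurable_def)
      with True r show ?thesis by (simp add: mL)
    next
      case False
      have "K \<inter> {y - r<..<y + r} = {}"
      proof (rule ccontr)
        assume "K \<inter> {y - r<..<y + r} \<noteq> {}"
        then obtain x where "x \<in> K" "dist y x < r" by (force simp: dist_real_def)
        with infdist_le2[of x K y r] infdist_le[of x K y] False show False by force
      qed
      with r show ?thesis by (simp add: mL indicator_def)
    qed
  qed
  also have "\<dots> = 2 * r * measure M {y. infdist y K < r}"
    using nb sets.sets_into_space[of "{y. infdist y K < r}" M] by (simp add: smu Int_absorb2)
  finally show ?thesis by (simp add: L_def)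
qed

section \<open>Probability that the uncovered part of a compact set is null at a fixed time\<close>

text \<open>The second moment bound is applied to the pairs (w, x) with \<open>x\<close> uncovered,
  for Lebesgue measure on \<open>K\<close>. By \<open>avg\<close>, the number \<open>m\<close>
  bounds the mean over \<open>K\<close> of the hitting probability \<open>p x\<close>, and convexity
  converts this into a lower bound for the mean uncovered measure.\<close>

lemma (in prob_space) uncovered_null:
  fixes Y :: "nat \<Rightarrow> 'a \<Rightarrow> real" and K :: "real set"
  assumes indep: "indep_vars (\<lambda>_. borel) Y {1..}"
    and law: "\<And>k. 1 \<le> k \<Longrightarrow> distr M borel (Y k) = \<mu>"
    and K: "closed K" "bounded K" and r: "0 < r" and m: "0 \<le> m" "m \<le> 1"
    and avg: "2 * r * measure \<mu> {y. infdist y K < r} \<le> measure lborel K * m"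
  shows "{w\<in>space M. measure lborel {x\<in>K. \<forall>k\<in>{1..n}. r \<le> \<bar>x - Y k w\<bar>} = 0} \<in> events" (is "?null \<in> events")
    and "prob {w\<in>space M. measure lborel {x\<in>K. \<forall>k\<in>{1..n}. r \<le> \<bar>x - Y k w\<bar>} = 0}
           * (measure lborel K * (1 - m) ^ n) \<le> 4 * r"
proof -
  define L where "L = density lborel (indicator K)"
  have [measurable]: "K \<in> sets borel" using K by auto
  have [measurable_cong]: "sets L = sets borel" by (simp add: L_def)
  have fin: "emeasure lborel K < \<infinity>" by (rule emeasure_bounded_finite) fact
  have mL: "measure L S = measure lborel (K \<inter> S)" if "S \<in> sets borel" for S
    using that by (simp add: L_def measure_restricted)
  interpret L: finite_measure L
    by standard (use fin in \<open>simp add: L_def emeasure_restricted less_top[symmetric]\<close>)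
  have spL [simp]: "space L = UNIV" by (simp add: L_def)
  have Y: "Y k \<in> borel_measurable M" if "1 \<le> k" for k
    using indep that by (auto simp: indep_vars_def)
  interpret mu: prob_space \<mu>
    using prob_space_distr[OF Y[of 1]] law[of 1] by simp
  have smu [measurable_cong]: "sets \<mu> = sets borel"
    using law[of 1] by (metis order_refl sets_distr)
  have spmu [simp]: "space \<mu> = UNIV"
    using sets_eq_imp_space_eq[OF smu] by simp
  define p where "p x = measure \<mu> {x - r<..<x + r}" for x
  define C where "C x = - {x - r<..<x + r}" for x
  have p01: "0 \<le> p x" "p x \<le> 1" for x by (auto simp: p_def)
  have mC: "measure \<mu> (C x) = 1 - p x" for x
    using mu.prob_compl[of "{x - r<..<x + r}"] by (simp add: p_def C_def smu Compl_eq_Diff_UNIV)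
  define U where "U = {p\<in>space (M \<Otimes>\<^sub>M L). \<forall>k\<in>{1..n}. r \<le> \<bar>snd p - Y k (fst p)\<bar>}"
  have U: "U \<in> sets (M \<Otimes>\<^sub>M L)"
  proof -
    have [measurable]: "(\<lambda>p. Y k (fst p)) \<in> borel_measurable (M \<Otimes>\<^sub>M L)" if "k \<in> {1..n}" for k
      using Y[of k] that by (auto intro: measurable_compose[OF measurable_fst])
    have "(\<lambda>p. snd p) \<in> borel_measurable (M \<Otimes>\<^sub>M L)" by measurable
    then show ?thesis unfolding U_def
      by (intro sets.sets_Collect_finite_All borel_measurable_le) auto
  qed
  have q: "prob {w\<in>space M. (w, x) \<in> U} = (1 - p x) ^ n" for x
  proof -
    have "{w\<in>space M. (w, x) \<in> U} = {w\<in>space M. \<forall>k\<in>{1..n}. Y k w \<in> C x}"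
      by (auto simp: U_def C_def space_pair_measure not_less abs_le_iff abs_real_def split: if_splits)
    then show ?thesis
      using prob_iid_all[OF indep law, of "C x" n] by (simp add: mC C_def[symmetric]) (simp add: C_def mC)
  qed
  have bound: "prob {w\<in>space M. measure L (Pair w -` U) = 0}
      * (\<integral>x. prob {w\<in>space M. (w, x) \<in> U} \<partial>L) \<le> 4 * r"
  \<comment> \<open>The arcs of radius \<open>r\<close> around \<open>x\<close> and \<open>y\<close>
    can meet only if \<open>y\<close> lies in this interval; its length is the source of
    \<open>4 * r\<close>.\<close>
  proof (rule second_moment_section[where D = "\<lambda>x. {x - 2 * r<..<x + 2 * r}"])
    fix x y
    have "prob {w\<in>space M. (w, x) \<in> U \<and> (w, y) \<in> U} = prob {w\<in>space M. \<forall>k\<in>{1..n}. Y k w \<in> C x \<inter> C y}"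
      by (intro arg_cong[where f=prob]) (auto simp: U_def C_def space_pair_measure not_less abs_real_def split: if_splits)
    also have "\<dots> = measure \<mu> (C x \<inter> C y) ^ n"
      by (rule prob_iid_all[OF indep law]) (auto simp: C_def)
    finally have eq: "prob {w\<in>space M. (w, x) \<in> U \<and> (w, y) \<in> U} = measure \<mu> (C x \<inter> C y) ^ n" .
    show "prob {w\<in>space M. (w, x) \<in> U \<and> (w, y) \<in> U}
        \<le> prob {w\<in>space M. (w, x) \<in> U} * prob {w\<in>space M. (w, y) \<in> U}
          + prob {w\<in>space M. (w, x) \<in> U} * indicator {x - 2 * r<..<x + 2 * r} y"
    proof (cases "y \<in> {x - 2 * r<..<x + 2 * r}")
      case True
      have "measure \<mu> (C x \<inter> C y) \<le> measure \<mu> (C x)"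
        by (intro mu.finite_measure_mono) (auto simp: smu C_def)
      then have "measure \<mu> (C x \<inter> C y) ^ n \<le> (1 - p x) ^ n"
        by (auto simp: mC intro!: power_mono)
      with True p01 show ?thesis by (simp add: eq q add_increasing)
    next
      case False
      have "C x \<inter> C y = UNIV - ({x - r<..<x + r} \<union> {y - r<..<y + r})"
        by (auto simp: C_def)
      \<comment> \<open>Centres at least \<open>2 * r\<close> apart have disjoint arcs, so the
        hitting probabilities add up. The survival probability 1 - p x - p y is then below the
        product of the single ones, the difference being p x * p y.\<close>
      moreover have "measure \<mu> ({x - r<..<x + r} \<union> {y - r<..<y + r}) = p x + p y"
        unfolding p_def using False by (intro mu.finite_measure_Union) (auto simp: smu)
      ultimately have "measure \<mu> (C x \<inter> C y) = 1 - (p x + p y)"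
        using mu.prob_compl[of "{x - r<..<x + r} \<union> {y - r<..<y + r}"] by (simp add: smu)
      also have "\<dots> \<le> (1 - p x) * (1 - p y)"
        using p01 by (simp add: algebra_simps)
      finally have "measure \<mu> (C x \<inter> C y) ^ n \<le> ((1 - p x) * (1 - p y)) ^ n"
        by (auto intro!: power_mono)
      with False show ?thesis by (simp add: eq q power_mult_distrib)
    qed
    have "measure lborel (K \<inter> {x - 2 * r<..<x + 2 * r}) \<le> measure lborel {x - 2 * r<..<x + 2 * r}"
      using r by (intro measure_mono_fmeasurable) (auto simp: fmeasurable_def)
    with r show "measure L {x - 2 * r<..<x + 2 * r} \<le> 4 * r" by (simp add: mL)
  qed (use r U L.finite_measure_axioms in \<open>auto simp: L_def\<close>)
  have section_eq: "measure L (Pair w -` U) = measure lborel {x\<in>K. \<forall>k\<in>{1..n}. r \<le> \<bar>x - Y k w\<bar>}"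
    if "w \<in> space M" for w
  proof -
    have "Pair w -` U = {x. \<forall>k\<in>{1..n}. r \<le> \<bar>x - Y k w\<bar>}"
      using that by (auto simp: U_def space_pair_measure)
    moreover have "Pair w -` U \<in> sets borel"
      using sets_Pair1[OF U, of w] by (simp add: L_def)
    ultimately show ?thesis by (simp add: mL Int_def)
  qed
  have "(\<lambda>w. measure L (Pair w -` U)) \<in> borel_measurable M"
    unfolding measure_def using L.measurable_emeasure_Pair[OF U] by simp
  then have "{w\<in>space M. measure L (Pair w -` U) = 0} \<in> events" by measurable
  also have null_eq: "{w\<in>space M. measure L (Pair w -` U) = 0} = ?null"
    using section_eq by (intro Collect_cong) auto
  finally show "?null \<in> events" .
  have "measure lborel K * (1 - m) ^ n \<le> (\<integral>x. (1 - p x) ^ n \<partial>L)"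
  proof -
    have [measurable]: "p \<in> borel_measurable borel"
      unfolding p_def using mu.finite_measure_axioms smu by (rule borel_measurable_measure_ball)
    have int: "integrable L p" "integrable L (\<lambda>x. (1 - p x) ^ n)"
      using p01 by (auto intro!: L.integrable_const_bound[where B=1] AE_I2 power_le_one)
    have "(\<integral>x. p x \<partial>L) \<le> measure lborel K * m"
      using integral_measure_ball_le[OF mu.finite_measure_axioms smu K r] avg unfolding p_def L_def by linarith
    moreover have "measure L UNIV = measure lborel K" by (simp add: mL)
    \<comment> \<open>The tangent is taken at \<open>1 - m\<close>. Its linear term is a nonnegative
      multiple of m - p x, whose integral over \<open>K\<close> is nonnegative by the bound on the
      mean of \<open>p\<close>.\<close>
    ultimately have "measure lborel K * (1 - m) ^ n
        \<le> (\<integral>x. (1 - m) ^ n + real n * (1 - m) ^ (n - 1) * ((1 - p x) - (1 - m)) \<partial>L)"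
      using int m by (simp add: right_diff_distrib[symmetric] mult.commute)
    also have "\<dots> \<le> (\<integral>x. (1 - p x) ^ n \<partial>L)"
      using int m p01 by (intro integral_mono power_tangent) auto
    finally show ?thesis .
  qed
  then have "prob ?null * (measure lborel K * (1 - m) ^ n) \<le> prob ?null * (\<integral>x. (1 - p x) ^ n \<partial>L)"
    by (intro mult_left_mono) auto
  with bound show "prob ?null * (measure lborel K * (1 - m) ^ n) \<le> 4 * r"
    by (simp add: q null_eq)
qed

section \<open>Uncovered mass at infinitely many times\<close>

text \<open>Along suitable times the probability that the uncovered part is null becomes arbitrarily
  small. Being null at all late suitable times is contained in each of these events and so has
  probability 0. The bound \<open>e\<close> on the arc length lets the arcs later be kept away from
  the cut point of the circle.\<close>

lemma (in prob_space) AE_frequently_uncovered: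
  fixes Y :: "nat \<Rightarrow> 'a \<Rightarrow> real" and B :: "real set" and l :: "nat \<Rightarrow> real"
  assumes indep: "indep_vars (\<lambda>_. borel) Y {1..}"
    and law: "\<And>k. 1 \<le> k \<Longrightarrow> distr M borel (Y k) = \<mu>"
    and B: "B \<in> sets borel" "bounded B" "0 < emeasure lborel B"
    and dom: "\<And>S. S \<in> sets borel \<Longrightarrow> S \<subseteq> B \<Longrightarrow> measure \<mu> S \<le> measure lborel S"
    and l: "\<And>n. 1 \<le> n \<Longrightarrow> 0 < l n"
    and c: "c < 1" "\<exists>\<^sub>F n in sequentially. real n * l n / ln (real n) \<le> c"
    and e: "0 < e"
  shows "AE w in M. \<forall>m. \<exists>n\<ge>m. l n \<le> e \<and>
           0 < emeasure lborel {x\<in>B. \<forall>k\<in>{1..n}. l n / 2 \<le> \<bar>x - Y k w\<bar>}"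
proof -
  have finB: "emeasure lborel B < \<infinity>" by (rule emeasure_bounded_finite) fact
  \<comment> \<open>Passing to a closed subset makes the neighbourhoods of \<open>K\<close> shrink
    to \<open>K\<close> itself, where \<open>dom\<close> applies; neighbourhoods of \<open>B\<close>
    could carry mass of \<open>\<mu>\<close> outside \<open>B\<close>.\<close>
  obtain K where K: "closed K" "K \<subseteq> B" "0 < measure lborel K"
  proof -
    define b where "b = measure lborel B"
    have b_eq: "emeasure lborel B = ennreal b"
      unfolding b_def using finB by (intro emeasure_eq_ennreal_measure) auto
    then have b: "0 < b" using B(3) by simp
    have Bleb: "B \<in> sets lebesgue" using B(1) by simp
    obtain T where T: "closed T" "T \<subseteq> B" "emeasure lebesgue (B - T) < ennreal b"
      by (rule sets_lebesgue_inner_closed[OF Bleb b]) blast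
    have "emeasure lborel T \<noteq> 0"
    proof
      assume "emeasure lborel T = 0"
      moreover have "emeasure lborel B \<le> emeasure lborel T + emeasure lborel (B - T)"
        using B(1) T(1) by (subst plus_emeasure) (auto intro!: emeasure_mono)
      moreover have "emeasure lborel (B - T) = emeasure lebesgue (B - T)"
        proof -
      have "B - T \<in> sets lborel" using B(1) T(1) by simp
      then show ?thesis by (simp add: emeasure_completion main_part_sets)
    qed
      ultimately show False using T(3) unfolding b_eq by simp
    qed
    moreover have "emeasure lborel T < \<infinity>"
      by (rule le_less_trans[OF emeasure_mono finB]) (use T(2) B(1) in auto)
    ultimately have "0 < measure lborel T"
      by (simp add: measure_def enn2real_positive_iff gr_zeroI)
    with T that show ?thesis by metis
  qed
  define \<kappa> where "\<kappa> = measure lborel K"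
  have \<kappa>: "0 < \<kappa>" using K by (simp add: \<kappa>_def)
  have bK: "bounded K" using K B bounded_subset by blast
  have nK: "K \<noteq> {}" using \<kappa> by (auto simp: \<kappa>_def)
  \<comment> \<open>The maximum makes the constant positive, and \<open>d\<close> is the midpoint of
    \<open>c'\<close> and 1. The ratio \<open>d / c'\<close> > 1 is the room for enlarging
    \<open>K\<close> to a neighbourhood, while \<open>d\<close> < 1 still makes the final limit
    vanish.\<close>
  define c' where "c' = max c (1/2)"
  define d where "d = (1 + c') / 2"
  have cd: "0 < c'" "c' < 1" "c \<le> c'" "c' < d" "0 < d" "d < 1"
    using c by (auto simp: c'_def d_def max_def)
  have Y: "Y k \<in> borel_measurable M" if "1 \<le> k" for k
    using indep that by (auto simp: indep_vars_def)
  interpret mu: prob_space \<mu>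
    using prob_space_distr[OF Y[of 1]] law[of 1] by simp
  have smu: "sets \<mu> = sets borel"
    using law[of 1] by (metis order_refl sets_distr)
  obtain \<rho> where \<rho>: "0 < \<rho>" "measure \<mu> {y. infdist y K < \<rho>} < d / c' * \<kappa>"
  proof -
    define V where "V i = {y. infdist y K < 1 / real (Suc i)}" for i
    have "open (V i)" for i
      unfolding V_def by (intro open_Collect_less continuous_intros)
    then have "range V \<subseteq> sets \<mu>" by (auto simp: smu)
    moreover have "decseq V"
      unfolding V_def decseq_def by (auto intro: less_le_trans simp: frac_le)
    moreover have "(\<Inter>i. V i) = K"
    proof (intro equalityI subsetI)
      fix y assume y: "y \<in> (\<Inter>i. V i)"
      have "infdist y K \<le> 0"
      proof (rule ccontr)
        assume "\<not> infdist y K \<le> 0"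
        then obtain i where "1 / real (Suc i) < infdist y K"
          by (metis not_le nat_approx_posE)
        with y show False by (auto simp: V_def dest!: spec[of _ i])
      qed
      then show "y \<in> K"
        using K nK infdist_nonneg[of y K] by (simp add: in_closed_iff_infdist_zero)
    qed (auto simp: V_def)
    ultimately have "(\<lambda>i. measure \<mu> (V i)) \<longlonglongrightarrow> measure \<mu> K"
      using mu.finite_Lim_measure_decseq by metis
    moreover have "measure \<mu> K < d / c' * \<kappa>"
    proof -
      have "measure \<mu> K \<le> \<kappa>" unfolding \<kappa>_def using K by (intro dom) auto
      also have "\<dots> < d / c' * \<kappa>" using cd \<kappa> by (simp add: field_simps)
      finally show ?thesis .
    qed
    ultimately have "\<forall>\<^sub>F i in sequentially. measure \<mu> (V i) < d / c' * \<kappa>"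
      by (rule order_tendstoD)
    then obtain i where "measure \<mu> (V i) < d / c' * \<kappa>"
      by (auto simp: eventually_sequentially)
    then show thesis using that[of "1 / real (Suc i)"] by (simp add: V_def)
  qed
  define Z where "Z n = {w\<in>space M. measure lborel {x\<in>K. \<forall>k\<in>{1..n}. l n / 2 \<le> \<bar>x - Y k w\<bar>} = 0}" for n
  have small: "\<exists>n\<ge>m. l n \<le> e \<and> Z n \<in> events \<and> prob (Z n) < \<epsilon>" if \<epsilon>: "0 < \<epsilon>" for m \<epsilon>
  proof -
    have "(\<lambda>n. c' * ln (real n) / real n) \<longlonglongrightarrow> 0" by real_asymp
    from order_tendstoD(2)[OF this, of "min e \<rho>"]
    have 1: "\<forall>\<^sub>F n in sequentially. c' * ln (real n) / real n < min e \<rho>" using e \<rho> by simp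
    have "(\<lambda>n. d * ln (real n) / real n) \<longlonglongrightarrow> 0" by real_asymp
    from order_tendstoD(2)[OF this, of 1]
    have 2: "\<forall>\<^sub>F n in sequentially. d * ln (real n) / real n < 1" by simp
    \<comment> \<open>The power in the denominator behaves like n^(-d), so the quotient is of order
      n^(d-1) ln n, which tends to 0.\<close>
    have "(\<lambda>n. (2 * c' / \<kappa> * ln (real n) / real n) / (1 - d * ln (real n) / real n) ^ n) \<longlonglongrightarrow> 0"
      using cd by real_asymp
    from order_tendstoD(2)[OF this \<epsilon>]
    have 3: "\<forall>\<^sub>F n in sequentially. (2 * c' / \<kappa> * ln (real n) / real n) / (1 - d * ln (real n) / real n) ^ n < \<epsilon>" .
    \<comment> \<open>The bound on \<open>l n\<close> holds only infinitely often, the other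
      conditions eventually, so they meet at some \<open>n\<close>. Requiring
      \<open>2 \<le> n\<close> makes the logarithm positive.\<close>
    have "\<exists>\<^sub>F n in sequentially. real n * l n / ln (real n) \<le> c \<and> (max m 2 \<le> n \<and>
        c' * ln (real n) / real n < min e \<rho> \<and> d * ln (real n) / real n < 1 \<and>
        (2 * c' / \<kappa> * ln (real n) / real n) / (1 - d * ln (real n) / real n) ^ n < \<epsilon>)"
      using c(2) 1 2 3 by (intro frequently_eventually_frequently eventually_conj eventually_ge_at_top)
    from frequently_ex[OF this] obtain n where n: "m \<le> n" "2 \<le> n" "real n * l n / ln (real n) \<le> c"
        "c' * ln (real n) / real n < e" "c' * ln (real n) / real n < \<rho>" "d * ln (real n) / real n < 1"
        "(2 * c' / \<kappa> * ln (real n) / real n) / (1 - d * ln (real n) / real n) ^ n < \<epsilon>"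
      by auto
    \<comment> \<open>\<open>t\<close> serves as \<open>m\<close> in the fixed-time bound: the
      factor c' ln n / n from \<open>l n\<close> and the factor (d / c') \<kappa> from the
      neighbourhood multiply to \<open>\<kappa> * t\<close>.\<close>
    define t where "t = d * ln (real n) / real n"
    have ln: "0 < ln (real n)" using n by simp
    have "l n \<le> c * ln (real n) / real n" using n ln by (simp add: field_simps)
    also have "\<dots> \<le> c' * ln (real n) / real n"
      using cd ln by (intro divide_right_mono mult_right_mono) auto
    finally have ln_le: "l n \<le> c' * ln (real n) / real n" .
    have ln0: "0 < l n" using l n by simp
    have t: "0 \<le> t" "t < 1" using cd ln n by (auto simp: t_def)
    have l_less: "l n / 2 < \<rho>" using ln_le n(5) ln0 by linarith
    have "measure \<mu> {y. infdist y K < l n / 2} \<le> measure \<mu> {y. infdist y K < \<rho>}"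
      using l_less by (intro mu.finite_measure_mono)
        (auto simp: smu intro!: borel_open open_Collect_less continuous_intros)
    also have "\<dots> \<le> d / c' * \<kappa>" using \<rho> by simp
    finally have "l n * measure \<mu> {y. infdist y K < l n / 2} \<le> (c' * ln (real n) / real n) * (d / c' * \<kappa>)"
      using ln_le ln0 by (intro mult_mono) auto
    also have "\<dots> = \<kappa> * t" using cd by (simp add: t_def)
    finally have avg: "2 * (l n / 2) * measure \<mu> {y. infdist y K < l n / 2} \<le> measure lborel K * t"
      by (simp add: \<kappa>_def)
    have hr: "0 < l n / 2" using ln0 by simp
    note Zn = uncovered_null[OF indep law K(1) bK hr t(1) less_imp_le[OF t(2)] avg, of n]
    have "prob (Z n) * (\<kappa> * (1 - t) ^ n) \<le> 2 * l n"
      using Zn(2) by (simp add: Z_def \<kappa>_def)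
    then have "prob (Z n) \<le> 2 * l n / (\<kappa> * (1 - t) ^ n)"
      using \<kappa> t by (simp add: pos_le_divide_eq)
    also have "\<dots> \<le> 2 * (c' * ln (real n) / real n) / (\<kappa> * (1 - t) ^ n)"
      using ln_le \<kappa> t by (intro divide_right_mono) auto
    also have "\<dots> = (2 * c' / \<kappa> * ln (real n) / real n) / (1 - t) ^ n" by (simp add: mult_ac)
    also have "\<dots> < \<epsilon>" using n(7) by (simp add: t_def)
    finally have "prob (Z n) < \<epsilon>" .
    moreover have "l n \<le> e" using ln_le n by simp
    ultimately show ?thesis using Zn(1) n(1) by (auto simp: Z_def)
  qed
  have "AE w in M. \<exists>n\<ge>m. l n \<le> e \<and> w \<notin> Z n" for m
  proof -
    \<comment> \<open>Only times with \<open>Z n\<close> an event are kept, which makes the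
      countable intersection measurable; \<open>small\<close> shows that there are such
      times.\<close>
    define N where "N = (\<Inter>n\<in>{n. m \<le> n \<and> l n \<le> e \<and> Z n \<in> events}. Z n)"
    have N: "N \<in> events"
      unfolding N_def using small[of 1 m] by (intro sets.countable_INT') auto
    have "prob N \<le> \<epsilon>" if \<epsilon>: "0 < \<epsilon>" for \<epsilon>
    proof -
      obtain n where n: "m \<le> n" "l n \<le> e" "Z n \<in> events" "prob (Z n) < \<epsilon>"
        using small[OF \<epsilon>] by blast
      then have "prob N \<le> prob (Z n)" by (intro finite_measure_mono) (auto simp: N_def)
      with n show ?thesis by simp
    qed
    then have "prob N = 0"
      by (metis field_le_epsilon add_0 measure_nonneg order_antisym)
    then have "N \<in> null_sets M" using N by (simp add: null_sets_def emeasure_eq_measure)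
    then have "AE w in M. w \<notin> N" by (rule AE_not_in)
    then show ?thesis by eventually_elim (auto simp: N_def)
  qed
  then have "AE w in M. \<forall>m. \<exists>n\<ge>m. l n \<le> e \<and> w \<notin> Z n" by (simp add: AE_all_countable)
  then show ?thesis
  proof (rule AE_mp, intro AE_I2 impI allI)
    fix w m assume w: "w \<in> space M" "\<forall>m. \<exists>n\<ge>m. l n \<le> e \<and> w \<notin> Z n"
    then obtain n where n: "m \<le> n" "l n \<le> e" "w \<notin> Z n" by blast
    define H where "H = {x. \<forall>k\<in>{1..n}. l n / 2 \<le> \<bar>x - Y k w\<bar>}"
    have [measurable]: "H \<in> sets borel" unfolding H_def by measurable
    have "measure lborel (K \<inter> H) \<noteq> 0"
      using n(3) w(1) by (simp add: Z_def H_def Int_def)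
    then have "0 < emeasure lborel (K \<inter> H)"
      by (metis enn2real_0 measure_def zero_less_iff_neq_zero)
    also have "\<dots> \<le> emeasure lborel (B \<inter> H)"
      using K B by (intro emeasure_mono) auto
    finally show "\<exists>n\<ge>m. l n \<le> e \<and> 0 < emeasure lborel {x\<in>B. \<forall>k\<in>{1..n}. l n / 2 \<le> \<bar>x - Y k w\<bar>}"
      using n by (auto simp: H_def Int_def)
  qed
qed

section \<open>A common point from nested rational intervals\<close>

text \<open>The rational intervals inside \<open>U\<close> cover it and are countably many, so they
  cannot all meet \<open>A\<close> in a null set.\<close>

lemma ex_rational_interval_pos:
  fixes A U :: "real set"
  assumes A: "A \<in> sets borel" and "open U" and pos: "0 < emeasure lborel (A \<inter> U)"
  obtains p q where "p \<in> \<rat>" "q \<in> \<rat>" "{p..q} \<subseteq> U" "0 < emeasure lborel (A \<inter> {p..q})"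
proof -
  define J where "J = {z \<in> \<rat> \<times> \<rat>. {fst z..snd z} \<subseteq> U}"
  have "countable J"
    by (rule countable_subset[of _ "\<rat> \<times> \<rat>"]) (auto simp: J_def countable_rat)
  have "\<exists>z\<in>J. x \<in> {fst z..snd z}" if x: "x \<in> U" for x
  proof -
    obtain e where e: "0 < e" "{x - e<..<x + e} \<subseteq> U"
      using \<open>open U\<close>[unfolded open_contains_ball] x ball_eq_greaterThanLessThan by metis
    obtain p where "p \<in> \<rat>" "x - e < p" "p < x" using Rats_dense_in_real[of "x - e" x] e by auto
    moreover obtain q where "q \<in> \<rat>" "x < q" "q < x + e" using Rats_dense_in_real[of x "x + e"] e by auto
    ultimately show ?thesis
      using e by (intro bexI[of _ "(p, q)"]) (auto simp: J_def)
  qed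
  then have cover: "A \<inter> U \<subseteq> (\<Union>z\<in>J. A \<inter> {fst z..snd z})" by blast
  have "\<exists>z\<in>J. emeasure lborel (A \<inter> {fst z..snd z}) \<noteq> 0"
  proof (rule ccontr)
    assume "\<not> ?thesis"
    then have "(\<Union>z\<in>J. A \<inter> {fst z..snd z}) \<in> null_sets lborel"
      using \<open>countable J\<close> A by (intro null_sets_UN') auto
    with cover have "A \<inter> U \<in> null_sets lborel"
      using A \<open>open U\<close> by (auto intro: null_sets_subset)
    with pos show False by auto
  qed
  then show thesis
    using that by (auto simp: J_def zero_less_iff_neq_zero)
qed

text \<open>Upgrades positive mass at infinitely many times to one point lying in infinitely many
  \<open>G n\<close>. Restricting \<open>step\<close> to rational endpoints leaves countably many
  conditions, which can hold simultaneously almost surely. The finite sets \<open>F n\<close>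
  contain the boundary points of \<open>G n\<close>.\<close>

lemma ex_frequently_mem:
  fixes A U :: "real set" and G :: "nat \<Rightarrow> real set"
  assumes A: "A \<in> sets borel" and U: "open U" "0 < emeasure lborel (A \<inter> U)"
    and G: "\<And>n. G n \<in> sets borel" "\<And>n. finite (F n)" "\<And>n. open (G n - F n)"
    and step: "\<And>p q m. p \<in> \<rat> \<Longrightarrow> q \<in> \<rat> \<Longrightarrow> {p..q} \<subseteq> U \<Longrightarrow> 0 < emeasure lborel (A \<inter> {p..q}) \<Longrightarrow>
      \<exists>n\<ge>m. 0 < emeasure lborel (A \<inter> {p..q} \<inter> G n)"
  shows "\<exists>x\<in>U. \<forall>m. \<exists>n\<ge>m. x \<in> G n"
proof -
  define P where "P z \<longleftrightarrow> fst z \<in> \<rat> \<and> snd z \<in> \<rat> \<and> {fst z..snd z} \<subseteq> U \<and>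
    0 < emeasure lborel (A \<inter> {fst z..snd z})" for z
  have "\<exists>z'. P z' \<and> {fst z'..snd z'} \<subseteq> {fst z..snd z} \<and> (\<exists>n\<ge>m. {fst z'..snd z'} \<subseteq> G n)"
    if z: "P z" for z m
  proof -
    obtain n where n: "m \<le> n" "0 < emeasure lborel (A \<inter> {fst z..snd z} \<inter> G n)"
      using step[of "fst z" "snd z" m] z by (auto simp: P_def)
    \<comment> \<open>\<open>V\<close> is an open part of the current interval and of
      \<open>G n\<close>. What is discarded lies in the finite set \<open>E\<close>, so
      \<open>A\<close> keeps positive mass in \<open>V\<close>, and a smaller rational interval fits
      inside.\<close>
    define V where "V = {fst z<..<snd z} \<inter> (G n - F n)"
    define E where "E = {fst z, snd z} \<union> F n"
    have "open V" using G by (simp add: V_def open_Int)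
    have "E \<in> null_sets lborel" using G(2) by (simp add: E_def finite_imp_null_set_lborel)
    have "0 < emeasure lborel (A \<inter> V)"
    proof (rule ccontr)
      assume "\<not> ?thesis"
      then have "A \<inter> V \<in> null_sets lborel"
        using A \<open>open V\<close> by (auto simp: null_sets_def)
      with \<open>E \<in> _\<close> have "A \<inter> V \<union> E \<in> null_sets lborel" by auto
      moreover have "A \<inter> {fst z..snd z} \<inter> G n \<subseteq> A \<inter> V \<union> E" by (auto simp: V_def E_def)
      ultimately have "A \<inter> {fst z..snd z} \<inter> G n \<in> null_sets lborel"
        using A G(1) by (auto intro: null_sets_subset)
      with n show False by auto
    qed
    from ex_rational_interval_pos[OF A \<open>open V\<close> this] obtain p q
      where pq: "p \<in> \<rat>" "q \<in> \<rat>" "{p..q} \<subseteq> V" "0 < emeasure lborel (A \<inter> {p..q})" .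
    have "V \<subseteq> {fst z..snd z}" "V \<subseteq> G n" by (auto simp: V_def)
    with pq(3) have "{p..q} \<subseteq> {fst z..snd z}" "{p..q} \<subseteq> G n" by blast+
    moreover from this z have "{p..q} \<subseteq> U" unfolding P_def by blast
    ultimately show ?thesis
      using pq n(1) unfolding P_def by (metis fst_conv snd_conv)
  qed
  moreover have "\<exists>z. P z"
    using ex_rational_interval_pos[OF A U] unfolding P_def by (metis fst_conv snd_conv)
  \<comment> \<open>Dependent choice: stage \<open>Suc m\<close> lies inside some \<open>G n\<close>
    with \<open>m \<le> n\<close>, so every point common to all stages is in \<open>G n\<close> for
    arbitrarily late \<open>n\<close>.\<close>
  ultimately obtain z where z: "\<And>m. P (z m)" "\<And>m. {fst (z (Suc m))..snd (z (Suc m))} \<subseteq> {fst (z m)..snd (z m)}"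
    "\<And>m. \<exists>n\<ge>m. {fst (z (Suc m))..snd (z (Suc m))} \<subseteq> G n"
    using dependent_nat_choice[of "\<lambda>_. P" "\<lambda>m z z'. {fst z'..snd z'} \<subseteq> {fst z..snd z} \<and>
      (\<exists>n\<ge>m. {fst z'..snd z'} \<subseteq> G n)"] by metis
  have "(\<Inter>m. {fst (z m)..snd (z m)}) \<noteq> {}"
  proof (rule compact_nest)
    \<comment> \<open>Carrying positive mass of \<open>A\<close> rules out an empty
      interval.\<close>
    show "{fst (z m)..snd (z m)} \<noteq> {}" for m
      using z(1)[of m] unfolding P_def by force
    show "{fst (z n)..snd (z n)} \<subseteq> {fst (z m)..snd (z m)}" if "m \<le> n" for m n
      using that z(2) by (rule lift_Suc_antimono_le[rotated])
  qed auto
  then obtain x where x: "\<And>m. x \<in> {fst (z m)..snd (z m)}" by blast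
  have "x \<in> U" using x[of 0] z(1)[of 0] by (auto simp: P_def)
  moreover have "\<exists>n\<ge>m. x \<in> G n" for m
    using z(3)[of m] x[of "Suc m"] by blast
  ultimately show ?thesis by blast
qed

section \<open>The coordinate of the circle in [0,1)\<close>

text \<open>\<open>rep_circle\<close> picks an unspecified representative; \<open>frac\<close>
  normalises it into [0,1).\<close>

definition circle_coord :: "circle \<Rightarrow> real" where
  "circle_coord x = frac (rep_circle x)"

lemma circle_coord_range: "0 \<le> circle_coord x" "circle_coord x < 1"
  by (simp_all add: circle_coord_def frac_lt_1)

lemma abs_circle_coord: "abs_circle (circle_coord x) = x"
proof -
  have "abs_circle (circle_coord x) = abs_circle (rep_circle x)"
    by (simp add: circle.abs_eq_iff circle_coord_def frac_def)
  then show ?thesis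
    using Quotient3_abs_rep[OF Quotient3_circle] by simp
qed

lemma circle_coord_abs:
  assumes "0 \<le> t" "t < 1"
  shows "circle_coord (abs_circle t) = t"
proof -
  define s where "s = circle_coord (abs_circle t)"
  have "s - t \<in> \<int>"
    unfolding s_def circle.abs_eq_iff[symmetric] by (rule abs_circle_coord)
  moreover have "\<bar>s - t\<bar> < 1"
    using circle_coord_range[of "abs_circle t"] assms unfolding s_def by linarith
  ultimately have "s - t = 0" by (rule Ints_nonzero_abs_less1)
  then show ?thesis by (simp add: s_def)
qed

text \<open>The preimage of the image is the union of all integer translates of
  \<open>U\<close>.\<close>

lemma open_abs_circle_image:
  assumes "open U"
  shows "open (abs_circle ` U)"
proof -
  have "abs_circle -` (abs_circle ` U) = (\<Union>m::int. (+) (of_int m) ` U)"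
  proof (intro equalityI subsetI)
    fix t assume "t \<in> abs_circle -` (abs_circle ` U)"
    then obtain s where s: "s \<in> U" "t - s \<in> \<int>"
      by (auto simp: circle.abs_eq_iff)
    then obtain m where "t - s = of_int m" by (auto elim: Ints_cases)
    then have "t = of_int m + s" by simp
    with s show "t \<in> (\<Union>m::int. (+) (of_int m) ` U)" by blast
  next
    fix t assume "t \<in> (\<Union>m::int. (+) (of_int m) ` U)"
    then obtain m :: int and s where "s \<in> U" "t = of_int m + s" by blast
    then have "abs_circle t = abs_circle s" by (simp add: circle.abs_eq_iff)
    with \<open>s \<in> U\<close> show "t \<in> abs_circle -` (abs_circle ` U)" by simp
  qed
  moreover have "open \<dots>"
    using assms by (intro open_UN ballI open_translation)
  ultimately show ?thesis by (simp add: open_circle_def)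
qed

lemma measurable_circle_coord: "circle_coord \<in> borel \<rightarrow>\<^sub>M borel"
proof -
  have "{x. a < circle_coord x} \<in> sets borel" for a
  proof (cases "0 \<le> a")
    case True
    \<comment> \<open>The coordinate jumps at the class of 0, but for nonnegative \<open>a\<close>
      its strict superlevel sets avoid that class and are images of open intervals.\<close>
    have "{x. a < circle_coord x} = abs_circle ` {a<..<1}"
    proof (intro equalityI subsetI)
      fix x assume "x \<in> {x. a < circle_coord x}"
      then show "x \<in> abs_circle ` {a<..<1}"
        using circle_coord_range[of x] by (intro image_eqI[of _ _ "circle_coord x"]) (auto simp: abs_circle_coord)
    qed (use True in \<open>auto simp: circle_coord_abs\<close>)
    then show ?thesis by (simp add: open_abs_circle_image borel_open)
  next
    case False
    then have "{x. a < circle_coord x} = UNIV"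
      using less_le_trans[OF _ circle_coord_range(1)] by (auto simp: not_le)
    then show ?thesis by simp
  qed
  then show ?thesis by (simp add: borel_measurable_iff_greater)
qed

text \<open>For \<open>t\<close> at distance at least \<open>r\<close> from 0 and 1 there is no
  wrap-around: a representative \<open>s\<close> of the same class within \<open>r\<close> of the
  coordinate of \<open>x\<close> differs from \<open>t\<close> by less than 1, hence equals
  \<open>t\<close>.\<close>

lemma abs_circle_mem_arc_ball_iff:
  assumes "r \<le> t" "t \<le> 1 - r"
  shows "abs_circle t \<in> arc_ball x r \<longleftrightarrow> \<bar>t - circle_coord x\<bar> < r"
proof -
  have eq: "arc_ball x r = abs_circle ` {circle_coord x - r<..<circle_coord x + r}"
    using arc_ball_abs[of "circle_coord x" r] by (simp add: abs_circle_coord)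
  show ?thesis
  proof
    assume "abs_circle t \<in> arc_ball x r"
    then obtain s where s: "circle_coord x - r < s" "s < circle_coord x + r" "t - s \<in> \<int>"
      by (auto simp: eq circle.abs_eq_iff)
    moreover have "\<bar>t - s\<bar> < 1"
      using s assms circle_coord_range[of x] by linarith
    ultimately have "t - s = 0" by (intro Ints_nonzero_abs_less1)
    with s(1,2) show "\<bar>t - circle_coord x\<bar> < r" by linarith
  next
    assume "\<bar>t - circle_coord x\<bar> < r"
    then have "t \<in> {circle_coord x - r<..<circle_coord x + r}" by (auto simp: abs_less_iff)
    then show "abs_circle t \<in> arc_ball x r" unfolding eq by (rule imageI)
  qed
qed

lemma sets_circle_lebesgue [measurable_cong]: "sets circle_lebesgue = sets borel"
  by (simp add: circle_lebesgue_def)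

lemma space_circle_lebesgue [simp]: "space circle_lebesgue = UNIV"
  by (simp add: circle_lebesgue_def)

section \<open>The law of the coordinate where the density is at most 1\<close>

text \<open>If \<open>f\<close> exceeded 1 almost everywhere, its integral over a probability space
  would exceed 1.\<close>

lemma circle_density_le_1_pos:
  assumes "circle_density f"
  shows "{t\<in>{0<..<1}. f (abs_circle t) \<le> 1} \<in> sets borel" (is "?A \<in> _")
    and "0 < emeasure lborel {t\<in>{0<..<1}. f (abs_circle t) \<le> 1}"
proof -
  have int: "integrable circle_lebesgue f" "integral\<^sup>L circle_lebesgue f = 1"
    using assms by (auto simp: circle_density_def)
  then have f [measurable]: "f \<in> borel_measurable borel"
    using borel_measurable_integrable[OF int(1)] by simp
  note measurable_abs_circle [measurable]
  show A: "?A \<in> sets borel" by measurable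
  interpret prob_space circle_lebesgue by (rule prob_space_circle_lebesgue)
  show "0 < emeasure lborel ?A"
  proof (rule ccontr)
    assume "\<not> ?thesis"
    then have "?A \<in> null_sets lborel" using A by (auto simp: null_sets_def)
    then have "AE t in lborel. t \<notin> ?A" by (rule AE_not_in)
    \<comment> \<open>The set leaves out 0 while the circle is parametrised by [0,1); the single
      point is null.\<close>
    then have "AE t in lborel. t \<in> {0..<1} \<longrightarrow> 1 < f (abs_circle t)"
      using AE_lborel_singleton[of 0] by eventually_elim force
    then have "AE t in restrict_space lborel {0..<1}. 1 < f (abs_circle t)"
      by (subst AE_restrict_space_iff) auto
    then have "AE x in circle_lebesgue. 1 < f x"
      unfolding circle_lebesgue_def
      by (subst AE_distr_iff) (use measurable_abs_circle in \<open>auto intro: measurable_restrict_space1\<close>)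
    then have "(\<integral>x. 1 \<partial>circle_lebesgue) < (\<integral>x. f x \<partial>circle_lebesgue)"
      using int emeasure_space_1 by (intro integral_less_AE_space) auto
    with int show False using prob_space by simp
  qed
qed

text \<open>On [0,1) the coordinate inverts \<open>abs_circle\<close>, so the pushed-forward law has
  Lebesgue density f(abs_circle t) there, which is at most 1 on \<open>S\<close>.\<close>

lemma emeasure_coord_density_le:
  assumes f [measurable]: "f \<in> borel_measurable borel" and S: "S \<in> sets borel"
    and le: "\<And>t. t \<in> S \<Longrightarrow> f (abs_circle t) \<le> 1"
  shows "emeasure (distr (density circle_lebesgue (\<lambda>x. ennreal (f x))) borel circle_coord) S
           \<le> emeasure lborel S"
proof -
  note measurable_abs_circle [measurable] measurable_circle_coord [measurable]
  have abs_meas: "abs_circle \<in> restrict_space lborel {0..<1} \<rightarrow>\<^sub>M borel"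
    by (rule measurable_restrict_space1) simp
  have S' [measurable]: "circle_coord -` S \<in> sets borel"
    using measurable_sets[OF measurable_circle_coord S] by simp
  have "emeasure (distr (density circle_lebesgue (\<lambda>x. ennreal (f x))) borel circle_coord) S
      = emeasure (density circle_lebesgue (\<lambda>x. ennreal (f x))) (circle_coord -` S)"
    using S by (subst emeasure_distr) auto
  also have "\<dots> = (\<integral>\<^sup>+x. ennreal (f x) * indicator (circle_coord -` S) x \<partial>circle_lebesgue)"
    by (rule emeasure_density) (simp_all add: sets_circle_lebesgue)
  also have "\<dots> = (\<integral>\<^sup>+t. ennreal (f (abs_circle t)) * indicator (circle_coord -` S) (abs_circle t)
      \<partial>restrict_space lborel {0..<1})"
    unfolding circle_lebesgue_def by (rule nn_integral_distr[OF abs_meas]) measurable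
  also have "\<dots> \<le> (\<integral>\<^sup>+t. indicator S t \<partial>restrict_space lborel {0..<1})"
    using le by (intro nn_integral_mono) (auto simp: space_restrict_space circle_coord_abs indicator_def ennreal_le_1)
  also have "\<dots> = (\<integral>\<^sup>+t. indicator S t * indicator {0..<1} t \<partial>lborel)"
    by (rule nn_integral_restrict_space) simp
  also have "\<dots> \<le> (\<integral>\<^sup>+t. indicator S t \<partial>lborel)"
    by (intro nn_integral_mono) (auto simp: indicator_def)
  also have "\<dots> = emeasure lborel S" using S by simp
  finally show ?thesis .
qed

section \<open>A point of the circle that is uncovered infinitely often\<close>

theorem corollary2:
  fixes l :: "nat \<Rightarrow> real" and M :: "'a measure"
  assumes "\<forall>n\<ge>1. 0 < l n \<and> l n < 1"
    and "antimono_on {1..} l"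
    and "liminf (\<lambda>n. ereal (real n * l n / ln (real n))) < 1"
    and "prob_space M"
  shows "\<not> (\<exists>f. circle_density f \<and>
             (\<exists>X. iid_with_density M X f \<and>
                  (AE w in M. UNIV \<subseteq> uniformly_covered l (\<lambda>k. X k w))))"
proof clarify
  fix f X
  assume f: "circle_density f" and X: "iid_with_density M X f"
    and cov: "AE w in M. UNIV \<subseteq> uniformly_covered l (\<lambda>k. X k w)"
  interpret prob_space M by fact
  have fm [measurable]: "f \<in> borel_measurable borel"
    using f borel_measurable_integrable by (fastforce simp: circle_density_def)
  \<comment> \<open>The level \<open>y\<close> below 1 that is undercut infinitely often is an
    extended real, possibly minus infinity; a real \<open>c\<close> is inserted between it and
    1.\<close>
  obtain c where c: "c < 1" "\<exists>\<^sub>F n in sequentially. real n * l n / ln (real n) \<le> c"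
  proof -
    from assms(3) have "\<not> 1 \<le> liminf (\<lambda>n. ereal (real n * l n / ln (real n)))" by simp
    then obtain y where y: "y < 1" "\<exists>\<^sub>F n in sequentially. ereal (real n * l n / ln (real n)) \<le> y"
      by (auto simp: le_Liminf_iff frequently_def not_le)
    obtain c where "y < ereal c" "ereal c < 1" using ereal_dense2[OF y(1)] by auto
    with y(2) show thesis
      by (intro that[of c]) (auto elim!: frequently_elim1 dest: le_less_trans)
  qed
  define A where "A = {t\<in>{0<..<1}. f (abs_circle t) \<le> 1}"
  note A = circle_density_le_1_pos[OF f, folded A_def]
  define Y where "Y k w = circle_coord (X k w)" for k w
  define \<mu> where "\<mu> = distr (density circle_lebesgue (\<lambda>x. ennreal (f x))) borel circle_coord"
  have indep: "indep_vars (\<lambda>_. borel) Y {1..}"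
  proof -
    have "indep_vars (\<lambda>_. borel) X {1..}" using X by (simp add: iid_with_density_def)
    from indep_vars_compose2[OF this, of "\<lambda>_. circle_coord" "\<lambda>_. borel"]
    show ?thesis unfolding Y_def[abs_def] using measurable_circle_coord by simp
  qed
  have law: "distr M borel (Y k) = \<mu>" if "1 \<le> k" for k
  proof -
    have D: "distributed M circle_lebesgue (X k) (\<lambda>x. ennreal (f x))"
      using X that by (simp add: iid_with_density_def)
    have "\<mu> = distr (distr M circle_lebesgue (X k)) borel circle_coord"
      using distributed_distr_eq_density[OF D] by (simp add: \<mu>_def)
    also have "\<dots> = distr M borel (circle_coord \<circ> X k)"
      using distributed_measurable[OF D] measurable_circle_coord
      by (intro distr_distr) (auto simp: measurable_cong_sets[OF sets_circle_lebesgue refl])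
    finally show ?thesis by (simp add: Y_def[abs_def] comp_def)
  qed
  have dom: "measure \<mu> S \<le> measure lborel S" if "S \<in> sets borel" "S \<subseteq> A" for S
  proof -
    have "S \<subseteq> {0..1}" using that by (auto simp: A_def)
    then have "emeasure lborel S < top"
      using emeasure_bounded_finite[OF bounded_subset[OF bounded_closed_interval]] by (metis infinity_ennreal_def)
    then show ?thesis
      unfolding measure_def \<mu>_def using that fm
      by (intro enn2real_mono emeasure_coord_density_le) (auto simp: A_def)
  qed
  \<comment> \<open>The first two conditions keep \<open>x\<close> half an arc length away from 0
    and 1, so that being uncovered on the circle can be read off from real distances.\<close>
  define G where "G w n = {x. l n / 2 \<le> x \<and> x \<le> 1 - l n / 2 \<and> (\<forall>k\<in>{1..n}. l n / 2 \<le> \<bar>x - Y k w\<bar>)}" for w n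
  have Gm: "G w n \<in> sets borel" for w n
    unfolding G_def by measurable
  have "AE w in M. \<forall>m. \<exists>n\<ge>m. 0 < emeasure lborel (A \<inter> {p..q} \<inter> G w n)"
    if pq: "{p..q} \<subseteq> {0<..<1}" "0 < emeasure lborel (A \<inter> {p..q})" for p q
  proof -
    have "p \<le> q" using pq(2) by (cases "p \<le> q") auto
    with pq(1) have p: "0 < p" "q < 1" by auto
    \<comment> \<open>This bound on \<open>l n\<close> gives \<open>l n / 2 \<le> p\<close> and
      \<open>q \<le> 1 - l n / 2\<close>, so every point of [p,q] meets the first two conditions of
      \<open>G\<close>.\<close>
    have "AE w in M. \<forall>m. \<exists>n\<ge>m. l n \<le> 2 * min p (1 - q) \<and>
        0 < emeasure lborel {x\<in>A \<inter> {p..q}. \<forall>k\<in>{1..n}. l n / 2 \<le> \<bar>x - Y k w\<bar>}"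
    proof (rule AE_frequently_uncovered[OF indep law _ _ pq(2) _ _ c])
      show "bounded (A \<inter> {p..q})" by (rule bounded_subset[of "{p..q}"]) auto
    qed (use A dom assms(1) p in auto)
    then show ?thesis
    proof eventually_elim
      case (elim w)
      show ?case
      proof
        fix m
        obtain n where n: "m \<le> n" "l n \<le> 2 * min p (1 - q)"
          "0 < emeasure lborel {x\<in>A \<inter> {p..q}. \<forall>k\<in>{1..n}. l n / 2 \<le> \<bar>x - Y k w\<bar>}"
          using elim by blast
        have "l n / 2 \<le> p" "q \<le> 1 - l n / 2"
          using n(2) by (auto simp: min_def split: if_splits)
        then have "{x\<in>A \<inter> {p..q}. \<forall>k\<in>{1..n}. l n / 2 \<le> \<bar>x - Y k w\<bar>} = A \<inter> {p..q} \<inter> G w n"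
          by (auto simp: G_def)
        with n show "\<exists>n\<ge>m. 0 < emeasure lborel (A \<inter> {p..q} \<inter> G w n)"
          by (intro exI[of _ n]) simp
      qed
    qed
  qed
  \<comment> \<open>There are only countably many rational pairs, so one null set serves all
    intervals.\<close>
  then have "AE w in M. \<forall>p\<in>\<rat>. \<forall>q\<in>\<rat>. {p..q} \<subseteq> {0<..<1} \<longrightarrow> 0 < emeasure lborel (A \<inter> {p..q}) \<longrightarrow>
      (\<forall>m. \<exists>n\<ge>m. 0 < emeasure lborel (A \<inter> {p..q} \<inter> G w n))"
    by (auto simp: AE_ball_countable countable_rat)
  with cov have "AE w in M. False"
  proof eventually_elim
    case (elim w)
    \<comment> \<open>The points at which one of the inequalities defining \<open>G w n\<close> is
      an equality; removing them leaves an open set.\<close>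
    define F where "F n = {l n / 2, 1 - l n / 2} \<union> (\<Union>k\<in>{1..n}. {x. \<bar>x - Y k w\<bar> = l n / 2})" for n
    have "\<exists>x\<in>{0<..<1}. \<forall>m. \<exists>n\<ge>m. x \<in> G w n"
    proof (rule ex_frequently_mem[of A _ _ F])
      show "0 < emeasure lborel (A \<inter> {0<..<1})"
        using A(2) by (simp add: A_def Int_def conj_commute cong: conj_cong)
      show "open (G w n - F n)" for n
      proof -
        have "G w n - F n = {l n / 2<..<1 - l n / 2} \<inter> (\<Inter>k\<in>{1..n}. {x. l n / 2 < \<bar>x - Y k w\<bar>})"
          unfolding G_def F_def by (simp add: set_eq_iff order_less_le) metis
        moreover have "open \<dots>"
          by (intro open_Int open_INT ballI open_Collect_less continuous_intros) auto
        ultimately show ?thesis by simp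
      qed
      have "{x. \<bar>x - a\<bar> = b} \<subseteq> {a - b, a + b}" for a b :: real by auto
      then have fin: "finite {x. \<bar>x - a\<bar> = b}" for a b :: real by (rule finite_subset) simp
      have "finite (\<Union>k\<in>{1..n}. {x. \<bar>x - Y k w\<bar> = l n / 2})" for n
        by (rule finite_UN_I[OF finite_atLeastAtMost fin])
      then show "finite (F n)" for n
        unfolding F_def by (rule finite_UnI[OF finite.insertI[OF finite.insertI[OF finite.emptyI]]])
    qed (use A(1) Gm elim(2) in auto)
    then obtain x where x: "\<forall>m. \<exists>n\<ge>m. x \<in> G w n" by blast
    have "abs_circle x \<in> uniformly_covered l (\<lambda>k. X k w)" using elim(1) by blast
    then obtain N where N: "\<And>n. N \<le> n \<Longrightarrow> abs_circle x \<in> covered_at l (\<lambda>k. X k w) n"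
      by (auto simp: uniformly_covered_def)
    \<comment> \<open>\<open>x\<close> is covered at every time from \<open>N\<close> on, yet lies
      in \<open>G w n\<close> for some such \<open>n\<close>, which puts it at distance at least
      \<open>l n / 2\<close> from every centre.\<close>
    obtain n where n: "N \<le> n" "x \<in> G w n" using x by blast
    then obtain k where k: "k \<in> {1..n}" "abs_circle x \<in> arc_ball (X k w) (l n / 2)"
      using N[of n] by (auto simp: covered_at_def)
    have "l n / 2 \<le> x" "x \<le> 1 - l n / 2" "l n / 2 \<le> \<bar>x - Y k w\<bar>"
      using n(2) k(1) unfolding G_def by blast+
    with k(2) show ?case
      by (simp add: abs_circle_mem_arc_ball_iff Y_def)
  qed
  then show False by simp
qed

end
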